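(* The semigroup $T(X,\mathcal{P})$ is unit-regular if and only if $X$ is finite and $\mathcal{P}$ is trivial.
   Context: $X$ is a nonempty set (possibly infinite) and $\mathcal{P}=\{X_i : i\in I\}$ is a partition of $X$ into nonempty blocks, with $X_i\cap X_j=\varnothing$ for $i\neq j$. The partition $\mathcal{P}$ is trivial if all its blocks are singletons or it has a single block. $T(X)$ denotes the semigroup of all maps $X\to X$ under composition; maps are written on the right. $T(X,\mathcal{P})$ is the subsemigroup (containing $\mathrm{id}_X$) of all $f\in T(X)$ such that for every $i\in I$ there is $j\in I$ with $X_if\subseteq X_j$. A semigroup $S$ with identity is unit-regular if for every $a\in S$ there is a unit $u$ of $S$ with $aua=a$. *)

theory Defs
  imports "HOL-Library.FuncSet" "HOL-Library.Disjoint_Sets" "HOL-Algebra.Group"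
begin

(* Self-maps of X are the extensional functions of X \<rightarrow>\<^sub>E X, so that HOL equality is equality
   of maps on X.  Maps act on the right: the product f g means "first f, then g". *)
definition full_trans_monoid :: "'a set \<Rightarrow> ('a \<Rightarrow> 'a) monoid" where
  "full_trans_monoid X =
     \<lparr>carrier = X \<rightarrow>\<^sub>E X,
      monoid.mult = (\<lambda>f g. compose X g f),
      one = restrict id X\<rparr>"

definition partition_trans_monoid :: "'a set \<Rightarrow> 'a set set \<Rightarrow> ('a \<Rightarrow> 'a) monoid" where
  "partition_trans_monoid X P =
     (full_trans_monoid X)
       \<lparr>carrier := {f \<in> carrier (full_trans_monoid X). \<forall>A\<in>P. \<exists>B\<in>P. f ` A \<subseteq> B}\<rparr>"

definition trivial_partition :: "'a set set \<Rightarrow> bool" where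
  "trivial_partition P \<longleftrightarrow> (\<forall>A\<in>P. is_singleton A) \<or> is_singleton P"

locale unit_regular_monoid = monoid +
  assumes unit_regular: "a \<in> carrier G \<Longrightarrow> \<exists>u\<in>Units G. a \<otimes> u \<otimes> a = a"

lemma monoid_full_trans_monoid: "monoid (full_trans_monoid X)"
  by (rule monoidI)
    (auto simp: full_trans_monoid_def compose_def fun_eq_iff PiE_iff extensional_def)

lemma monoid_partition_trans_monoid:
  assumes "partition_on X P"
  shows "monoid (partition_trans_monoid X P)"
proof -
  have sub: "A \<subseteq> X" if "A \<in> P" for A
    using assms that by (auto simp: partition_on_def)
  show ?thesis
  proof (rule monoidI)
    fix f g
    assume f: "f \<in> carrier (partition_trans_monoid X P)"
      and g: "g \<in> carrier (partition_trans_monoid X P)"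
    have "\<exists>C\<in>P. compose X g f ` A \<subseteq> C" if A: "A \<in> P" for A
    proof -
      obtain B where B: "B \<in> P" "f ` A \<subseteq> B"
        using f A by (auto simp: partition_trans_monoid_def)
      obtain C where C: "C \<in> P" "g ` B \<subseteq> C"
        using g B by (auto simp: partition_trans_monoid_def)
      have "compose X g f ` A \<subseteq> C"
        using sub[OF A] B C by (auto simp: compose_def)
      with C show ?thesis by blast
    qed
    with f g show "f \<otimes>\<^bsub>partition_trans_monoid X P\<^esub> g \<in> carrier (partition_trans_monoid X P)"
      by (auto simp: partition_trans_monoid_def full_trans_monoid_def compose_def PiE_iff)
  next
    have "\<exists>B\<in>P. restrict id X ` A \<subseteq> B" if "A \<in> P" for A
      using sub[OF that] that by (intro bexI[of _ A]) auto
    then show "\<one>\<^bsub>partition_trans_monoid X P\<^esub> \<in> carrier (partition_trans_monoid X P)"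
      by (auto simp: partition_trans_monoid_def full_trans_monoid_def)
  qed (auto simp: partition_trans_monoid_def full_trans_monoid_def compose_def fun_eq_iff
        PiE_iff extensional_def)
qed

end

theory Submission
  imports Defs
begin

text \<open>
  If the partition is not trivial, some block \<open>A\<close> has two distinct points \<open>a\<close>, \<open>b\<close>, and some point
  of \<open>X\<close> lies outside \<open>A\<close>.  Let \<open>f\<close> send \<open>A\<close> to \<open>a\<close> and the rest of \<open>X\<close> to \<open>b\<close>.  If \<open>f u f = f\<close>, then
  \<open>u\<close> must send \<open>a\<close> into \<open>A\<close> and \<open>b\<close> out of \<open>A\<close>, so it tears the block \<open>A\<close> apart: \<open>f\<close> is not even
  regular.  Hence unit-regularity forces the partition to be trivial.

  For a trivial partition the semigroup is the full transformation monoid, whose units are the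
  permutations of \<open>X\<close>.  There \<open>f u f = f\<close> says that \<open>u\<close> sends every point of the image of \<open>f\<close> to one
  of its preimages under \<open>f\<close>.  If \<open>X\<close> is infinite, it has an injective self-map that is not
  surjective; a \<open>u\<close> for this map already takes every value on the proper subset \<open>f ` X\<close>, so it is not
  injective.  If \<open>X\<close> is finite, choose one preimage for every point of the image; this is an
  injection defined on a subset of \<open>X\<close>, and every such injection extends to a permutation of \<open>X\<close>,
  because the complements of its domain and of its range have the same cardinality.
\<close>

lemma carrier_partition_trans_monoid:
  "carrier (partition_trans_monoid X P) = {f \<in> X \<rightarrow>\<^sub>E X. \<forall>A\<in>P. \<exists>B\<in>P. f ` A \<subseteq> B}"
  by (simp add: partition_trans_monoid_def full_trans_monoid_def)

lemma mult_partition_trans_monoid: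
  "f \<otimes>\<^bsub>partition_trans_monoid X P\<^esub> g = compose X g f"
  by (simp add: partition_trans_monoid_def full_trans_monoid_def)

lemma one_partition_trans_monoid:
  "\<one>\<^bsub>partition_trans_monoid X P\<^esub> = restrict id X"
  by (simp add: partition_trans_monoid_def full_trans_monoid_def)

lemma carrier_trivial_partition:
  assumes P: "partition_on X P" and triv: "trivial_partition P"
  shows "carrier (partition_trans_monoid X P) = X \<rightarrow>\<^sub>E X"
proof -
  have U: "\<Union>P = X" using P by (simp add: partition_on_def)
  have "\<exists>B\<in>P. f ` A \<subseteq> B" if f: "f \<in> X \<rightarrow>\<^sub>E X" and A: "A \<in> P" for f A
  proof (cases "is_singleton P")
    case True
    then have "A = X" using A U by (auto simp: is_singleton_def)
    then show ?thesis using A f by (intro bexI[of _ A]) auto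
  next
    case False
    then obtain x where x: "A = {x}"
      using triv A by (auto simp: trivial_partition_def is_singleton_def)
    then have "f x \<in> \<Union>P" using U A f by (auto simp: PiE_iff)
    then show ?thesis using x by auto
  qed
  then show ?thesis by (auto simp: carrier_partition_trans_monoid)
qed

lemma sandwich_eq_iff:
  assumes "f \<in> carrier (partition_trans_monoid X P)"
  shows "f \<otimes>\<^bsub>partition_trans_monoid X P\<^esub> u \<otimes>\<^bsub>partition_trans_monoid X P\<^esub> f = f
    \<longleftrightarrow> (\<forall>x\<in>X. f (u (f x)) = f x)"
proof -
  have "f \<in> extensional X"
    using assms by (simp add: carrier_partition_trans_monoid PiE_iff)
  then show ?thesis
    by (auto simp: mult_partition_trans_monoid compose_def fun_eq_iff extensional_def)
qed

lemma Units_inj_on: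
  assumes u: "u \<in> Units (partition_trans_monoid X P)"
  shows "inj_on u X"
proof -
  obtain v where v: "u \<otimes>\<^bsub>partition_trans_monoid X P\<^esub> v = \<one>\<^bsub>partition_trans_monoid X P\<^esub>"
    using u by (auto simp: Units_def)
  have "v (u x) = x" if "x \<in> X" for x
    using fun_cong[OF v, of x] that
    by (simp add: mult_partition_trans_monoid one_partition_trans_monoid compose_def)
  then show ?thesis by (rule inj_on_inverseI)
qed

lemma permutation_in_Units:
  assumes P: "partition_on X P" and triv: "trivial_partition P"
    and ext: "u \<in> extensional X" and bij: "bij_betw u X X"
  shows "u \<in> Units (partition_trans_monoid X P)"
proof -
  let ?v = "restrict (inv_into X u) X"
  have u: "u \<in> X \<rightarrow>\<^sub>E X" using ext bij by (auto simp: PiE_iff bij_betw_def)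
  have v: "?v \<in> X \<rightarrow>\<^sub>E X"
    using bij by (auto simp: bij_betw_def intro: inv_into_into)
  have 1: "compose X u ?v = restrict id X" "compose X ?v u = restrict id X"
    using bij u
    by (auto simp: compose_def fun_eq_iff bij_betw_def f_inv_into_f PiE_iff)
  from u v 1 show ?thesis
    by (auto simp: Units_def carrier_trivial_partition[OF P triv] mult_partition_trans_monoid
        one_partition_trans_monoid intro!: bexI[of _ ?v])
qed

lemma inj_on_extends_to_permutation:
  assumes X: "finite X" and "Y \<subseteq> X" and "inj_on s Y" and "s ` Y \<subseteq> X"
  obtains u where "u \<in> extensional X" "bij_betw u X X" "\<And>y. y \<in> Y \<Longrightarrow> u y = s y"
proof -
  have "card (X - Y) = card (X - s ` Y)"
    using assms by (simp add: card_Diff_subset card_image finite_subset[of Y X])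
  then obtain h where h: "bij_betw h (X - Y) (X - s ` Y)"
    using X finite_same_card_bij by blast
  let ?w = "\<lambda>x. if x \<in> Y then s x else h x"
  have "bij_betw ?w (Y \<union> (X - Y)) (s ` Y \<union> (X - s ` Y))"
    using h \<open>inj_on s Y\<close> by (intro bij_betw_disjoint_Un) (auto simp: bij_betw_def)
  moreover have "Y \<union> (X - Y) = X" "s ` Y \<union> (X - s ` Y) = X" using assms by auto
  ultimately have "bij_betw ?w X X" by simp
  then have "bij_betw (restrict ?w X) X X" by (simp cong: bij_betw_cong)
  moreover have "restrict ?w X y = s y" if "y \<in> Y" for y using that \<open>Y \<subseteq> X\<close> by auto
  ultimately show ?thesis using that[of "restrict ?w X"] by auto
qed

text \<open>
  The witness \<open>f\<close> below takes two values in one block \<open>A\<close>, and the preimages of these values are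
  \<open>A\<close> and its complement.  A map \<open>u\<close> that keeps \<open>A\<close> inside a single block cannot send both values
  back to preimages.
\<close>

lemma trivial_partition_if_regular:
  assumes P: "partition_on X P"
    and reg: "\<And>f. f \<in> carrier (partition_trans_monoid X P) \<Longrightarrow>
      \<exists>u\<in>carrier (partition_trans_monoid X P). \<forall>x\<in>X. f (u (f x)) = f x"
  shows "trivial_partition P"
proof (rule ccontr)
  assume nt: "\<not> trivial_partition P"
  have sub: "A \<subseteq> X" and ne: "A \<noteq> {}" if "A \<in> P" for A
    using P that by (auto simp: partition_on_def)
  have disj: "A \<inter> B = {}" if "A \<in> P" "B \<in> P" "A \<noteq> B" for A B
    using P that by (auto simp: partition_on_def disjoint_def)
  obtain A where A: "A \<in> P" "\<not> is_singleton A" "P \<noteq> {A}"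
    using nt by (auto simp: trivial_partition_def is_singleton_def)
  obtain a b where ab: "a \<in> A" "b \<in> A" "a \<noteq> b"
    using A ne by (metis all_not_in_conv is_singletonI')
  obtain B c where B: "B \<in> P" "c \<in> B" "B \<noteq> A"
    using A ne by (metis all_not_in_conv insertI1 subsetI subset_singletonD singletonD)
  have abX: "a \<in> X" "b \<in> X" using ab A sub by auto
  have c: "c \<in> X" "c \<notin> A" using B sub disj[of A B] A by auto
  define f where "f = (\<lambda>x\<in>X. if x \<in> A then a else b)"
  have f: "f \<in> carrier (partition_trans_monoid X P)"
  proof -
    have "f ` C \<subseteq> A" if "C \<in> P" for C
      using sub[OF that] ab by (auto simp: f_def)
    moreover have "f \<in> X \<rightarrow>\<^sub>E X" using abX by (auto simp: f_def)
    ultimately show ?thesis using A(1) unfolding carrier_partition_trans_monoid by blast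
  qed
  obtain u where u: "u \<in> carrier (partition_trans_monoid X P)"
    and fuf: "\<forall>x\<in>X. f (u (f x)) = f x"
    using reg[OF f] by blast
  have "u a \<in> X" "u b \<in> X"
    using u abX by (auto simp: carrier_partition_trans_monoid)
  moreover have "f (u a) = a" "f (u b) = b"
    using fuf[rule_format, of a] fuf[rule_format, of c] ab abX c by (auto simp: f_def)
  ultimately have in_out: "u a \<in> A" "u b \<notin> A" using ab by (auto simp: f_def split: if_splits)
  obtain C where "C \<in> P" "u ` A \<subseteq> C"
    using u A(1) by (auto simp: carrier_partition_trans_monoid)
  then show False using in_out ab disj[of A C] A(1) by auto
qed

lemma finite_if_unit_regular:
  assumes full: "carrier (partition_trans_monoid X P) = X \<rightarrow>\<^sub>E X"
    and reg: "unit_regular_monoid (partition_trans_monoid X P)"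
  shows "finite X"
proof (rule ccontr)
  assume "infinite X"
  then obtain y where y: "y \<in> X" by (metis finite.emptyI ex_in_conv)
  \<comment> \<open>An infinite set stays equipotent to itself when one point is removed.\<close>
  obtain h where h: "bij_betw h X (X - {y})"
    using infinite_imp_bij_betw[OF \<open>infinite X\<close>, of y] by blast
  define f where "f = restrict h X"
  have f: "f \<in> carrier (partition_trans_monoid X P)"
    using h full by (auto simp: f_def bij_betw_def)
  have inj: "inj_on f X" and img: "f ` X = X - {y}"
    using h by (auto simp: f_def bij_betw_def)
  obtain u where u: "u \<in> Units (partition_trans_monoid X P)"
    and "f \<otimes>\<^bsub>partition_trans_monoid X P\<^esub> u \<otimes>\<^bsub>partition_trans_monoid X P\<^esub> f = f"
    using unit_regular_monoid.unit_regular[OF reg f] by blast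
  then have fuf: "\<forall>x\<in>X. f (u (f x)) = f x" using sandwich_eq_iff[OF f] by blast
  have uX: "u x \<in> X" if "x \<in> X" for x using u that full by (auto simp: Units_def)
  have fX: "f x \<in> X" if "x \<in> X" for x using img that by blast
  have "u (f (u y)) = u y"
    using fuf inj uX fX y by (meson inj_onD)
  then have "f (u y) = y"
    using Units_inj_on[OF u] uX fX y by (meson inj_onD)
  then show False using img uX[OF y] by blast
qed

lemma unit_regular_if_finite_trivial:
  assumes P: "partition_on X P" and X: "finite X" and triv: "trivial_partition P"
  shows "unit_regular_monoid (partition_trans_monoid X P)"
proof (intro unit_regular_monoid.intro unit_regular_monoid_axioms.intro
    monoid_partition_trans_monoid[OF P])
  fix f assume f: "f \<in> carrier (partition_trans_monoid X P)"
  have fX: "f ` X \<subseteq> X" using f by (auto simp: carrier_partition_trans_monoid)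
  obtain u where u: "u \<in> extensional X" "bij_betw u X X"
    and eq: "\<And>y. y \<in> f ` X \<Longrightarrow> u y = inv_into X f y"
    by (rule inj_on_extends_to_permutation[OF X fX inj_on_inv_into[OF subset_refl]])
      (auto intro: inv_into_into)
  have "\<forall>x\<in>X. f (u (f x)) = f x" using eq by (simp add: f_inv_into_f)
  then show "\<exists>u\<in>Units (partition_trans_monoid X P).
      f \<otimes>\<^bsub>partition_trans_monoid X P\<^esub> u \<otimes>\<^bsub>partition_trans_monoid X P\<^esub> f = f"
    using permutation_in_Units[OF P triv u] sandwich_eq_iff[OF f] by blast
qed

theorem proposition4p8:
  fixes X :: "'a set" and P :: "'a set set"
  assumes "X \<noteq> {}" and "partition_on X P"
  shows "unit_regular_monoid (partition_trans_monoid X P) \<longleftrightarrow> finite X \<and> trivial_partition P"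
proof
  assume reg: "unit_regular_monoid (partition_trans_monoid X P)"
  have triv: "trivial_partition P"
  proof (rule trivial_partition_if_regular[OF assms(2)])
    fix f assume f: "f \<in> carrier (partition_trans_monoid X P)"
    show "\<exists>u\<in>carrier (partition_trans_monoid X P). \<forall>x\<in>X. f (u (f x)) = f x"
      using unit_regular_monoid.unit_regular[OF reg f] sandwich_eq_iff[OF f]
      by (auto simp: Units_def)
  qed
  then show "finite X \<and> trivial_partition P"
    using finite_if_unit_regular[OF carrier_trivial_partition[OF assms(2) triv] reg] by blast
next
  assume "finite X \<and> trivial_partition P"
  then show "unit_regular_monoid (partition_trans_monoid X P)"
    using unit_regular_if_finite_trivial[OF assms(2)] by blast
qed

end
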